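(* Let $p$ be a prime, let $e\geq 2$, and let $G=C_{p^e}\times H$, where $H$ is a finite abelian group whose Sylow $p$-subgroup has exponent less than $p^e$. Suppose that $t$ is an integer such that $t\equiv 1+p^{e-1}\pmod{p^{e}}$ and $t\equiv 1\pmod{\exp(H)}$. Then $t$ is not a multiplier of any non-trivial $(v,k,\lambda)$ difference set $D$ in $G$, with the possible exception of the case where $p=2$ and $D$ is a Hadamard difference set in a non-cyclic group.
   Context: $C_k$ denotes the cyclic group of order $k$. A $(v,k,\lambda)$ difference set $D$ is a $k$-subset of an abelian group $G$ of order $v$ such that every non-identity element of $G$ can be written as $d_1d_2^{-1}$ with $d_1,d_2\in D$ in exactly $\lambda$ ways. Its order is $n=k-\lambda$; throughout it is assumed that $k<v/2$, and $D$ is called non-trivial if $n>1$. For an integer $t$ coprime to $|G|$ and $D\subseteq G$, write $D^{(t)}=\{d^t: d\in D\}$; $t$ is a (numerical) multiplier of $D$ if $D^{(t)}=Dg$ for some $g\in G$. A Hadamard difference set is a difference set with parameters $(4u^2,2u^2-u,u^2-u)$ for some positive integer $u$. *)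

theory Defs
  imports
    "HOL-Algebra.Coset"
    "HOL-Algebra.Elementary_Groups"
    "HOL-Number_Theory.Cong"
begin

definition group_exponent :: "('a, 'm) monoid_scheme \<Rightarrow> nat" where
  "group_exponent G = (LEAST n::nat. 0 < n \<and> (\<forall>x \<in> carrier G. x [^]\<^bsub>G\<^esub> n = \<one>\<^bsub>G\<^esub>))"

definition sylow_subgroup :: "nat \<Rightarrow> 'a set \<Rightarrow> ('a, 'm) monoid_scheme \<Rightarrow> bool" where
  "sylow_subgroup p P G \<longleftrightarrow> subgroup P G \<and> card P = p ^ multiplicity p (order G)"

definition difference_set ::
    "('a, 'm) monoid_scheme \<Rightarrow> nat \<Rightarrow> nat \<Rightarrow> nat \<Rightarrow> 'a set \<Rightarrow> bool" where
  "difference_set G v k l D \<longleftrightarrow>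
     comm_group G \<and> finite (carrier G) \<and> order G = v \<and>
     D \<subseteq> carrier G \<and> card D = k \<and>
     (\<forall>g \<in> carrier G - {\<one>\<^bsub>G\<^esub>}.
        card {(d1, d2). d1 \<in> D \<and> d2 \<in> D \<and> d1 \<otimes>\<^bsub>G\<^esub> inv\<^bsub>G\<^esub> d2 = g} = l)"

definition multiplier :: "('a, 'm) monoid_scheme \<Rightarrow> 'a set \<Rightarrow> int \<Rightarrow> bool" where
  "multiplier G D t \<longleftrightarrow>
     coprime t (int (order G)) \<and>
     (\<exists>g \<in> carrier G. (\<lambda>d. d [^]\<^bsub>G\<^esub> t) ` D = D #>\<^bsub>G\<^esub> g)"

definition hadamard_parameters :: "nat \<Rightarrow> nat \<Rightarrow> nat \<Rightarrow> bool" where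
  "hadamard_parameters v k l \<longleftrightarrow>
     (\<exists>u>0. v = 4 * u\<^sup>2 \<and> k = 2 * u\<^sup>2 - u \<and> l = u\<^sup>2 - u)"

end

theory Submission
  imports Defs "HOL-Algebra.Multiplicative_Group" "HOL-Analysis.Convex"
begin

text \<open>
  Let \<open>z\<close> generate the subgroup of order \<open>p\<close> of \<open>C\<^bsub>p^e\<^esub>\<close>, let \<open>K\<close> be the subgroup of index \<open>p\<close> where
  the first coordinate is divisible by \<open>p\<close>, and \<open>n = k - \<lambda>\<close>. The map \<open>x \<mapsto> x^t\<close> fixes \<open>K\<close> pointwise and
  acts on each other coset of \<open>K\<close> as translation by a nontrivial power of \<open>z\<close>. If \<open>t\<close> is a
  multiplier, some translate of \<open>D\<close> is fixed, so we may assume that \<open>D - K\<close> is invariant under \<open>z\<close>.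
  Since \<open>z d \<in> D\<close> for only \<open>\<lambda>\<close> elements \<open>d\<close> of \<open>D\<close>, this forces \<open>|D \<inter> K| \<ge> n\<close> and \<open>|K - D| \<ge> n\<close>.
  On the other hand \<open>(p |D \<inter> K| - k)\<^sup>2 \<le> (p - 1)\<^sup>2 n\<close>, which together with \<open>k < 2n\<close> is impossible for odd
  \<open>p\<close> and leaves only the Hadamard parameters for \<open>p = 2\<close>.

  In that case \<open>D \<inter> K\<close> meets every coset of \<open>{1, z}\<close> in \<open>K\<close> exactly once, and for \<open>g \<in> K - {1, z}\<close>
  exactly half of the elements of \<open>D \<inter> K\<close> remain in \<open>D\<close> under translation by \<open>g\<close>. If \<open>G\<close> is cyclic, a
  generator of \<open>K\<close> turns \<open>D \<inter> K\<close> into a \<open>\<plusminus>1\<close> sequence of length \<open>n = u\<^sup>2\<close>, continued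
  negacyclically, with \<open>n/2\<close> sign changes; their number is odd, so \<open>n \<equiv> 2 (mod 4)\<close>, which no square
  satisfies.
\<close>

section \<open>Sign changes and power maps\<close>

lemma card_changes_odd_iff:
  fixes b :: "nat \<Rightarrow> bool"
  shows "odd (card {i. i < n \<and> b i \<noteq> b (Suc i)}) \<longleftrightarrow> b 0 \<noteq> b n"
proof (induction n)
  case (Suc n)
  have "{i. i < Suc n \<and> b i \<noteq> b (Suc i)} =
      (if b n \<noteq> b (Suc n) then insert n {i. i < n \<and> b i \<noteq> b (Suc i)}
       else {i. i < n \<and> b i \<noteq> b (Suc i)})"
    by (auto simp: less_Suc_eq)
  then show ?case
    using Suc by auto
qed simp

lemma (in group) pow_group_exponent:
  assumes "finite (carrier G)" and "x \<in> carrier G"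
  shows "x [^] group_exponent G = \<one>"
proof -
  have "0 < order G \<and> (\<forall>x \<in> carrier G. x [^] order G = \<one>)"
    using assms by (simp add: pow_order_eq_1 order_gt_0_iff_finite)
  from LeastI[of "\<lambda>n. 0 < n \<and> (\<forall>x \<in> carrier G. x [^] n = \<one>)", OF this] assms(2)
  show ?thesis
    unfolding group_exponent_def by blast
qed

lemma int_pow_DirProd:
  assumes "group G" and "group H" and "x \<in> carrier G" and "y \<in> carrier H"
  shows "(x, y) [^]\<^bsub>G \<times>\<times> H\<^esub> (i::int) = (x [^]\<^bsub>G\<^esub> i, y [^]\<^bsub>H\<^esub> i)"
proof -
  interpret G: group G by fact
  interpret H: group H by fact
  have nat: "(x, y) [^]\<^bsub>G \<times>\<times> H\<^esub> (n::nat) = (x [^]\<^bsub>G\<^esub> n, y [^]\<^bsub>H\<^esub> n)" for n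
    by (induction n) simp_all
  have inv: "inv\<^bsub>G \<times>\<times> H\<^esub> (x [^]\<^bsub>G\<^esub> n, y [^]\<^bsub>H\<^esub> n) = (inv\<^bsub>G\<^esub> (x [^]\<^bsub>G\<^esub> n), inv\<^bsub>H\<^esub> (y [^]\<^bsub>H\<^esub> n))"
    for n :: nat
    using assms by (intro inv_DirProd) auto
  show ?thesis
    by (cases "i < 0") (simp_all only: int_pow_def2 nat inv if_True if_False)
qed

section \<open>Counting pairs in a difference set by their quotients\<close>

lemma card_difference_set_shift:
  fixes G (structure)
  assumes ds: "difference_set G v k l D" and g: "g \<in> carrier G" "g \<noteq> \<one>"
  shows "card {d \<in> D. g \<otimes> d \<in> D} = l"
proof -
  interpret comm_group G
    using ds by (simp add: difference_set_def)
  have D: "d \<in> carrier G" if "d \<in> D" for d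
    using ds that by (auto simp: difference_set_def)
  have "bij_betw (\<lambda>d. (g \<otimes> d, d)) {d \<in> D. g \<otimes> d \<in> D}
      {(c, d). c \<in> D \<and> d \<in> D \<and> c \<otimes> inv d = g}"
    by (rule bij_betw_byWitness[where f' = snd])
      (use D g in \<open>auto simp: m_assoc inv_solve_right\<close>)
  then have "card {d \<in> D. g \<otimes> d \<in> D} = card {(c, d). c \<in> D \<and> d \<in> D \<and> c \<otimes> inv d = g}"
    by (rule bij_betw_same_card)
  then show ?thesis
    using ds g by (simp add: difference_set_def)
qed

lemma card_difference_set_shift_one:
  fixes G (structure)
  assumes ds: "difference_set G v k l D"
  shows "card {d \<in> D. \<one> \<otimes> d \<in> D} = k"
proof -
  interpret comm_group G
    using ds by (simp add: difference_set_def)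
  have "{d \<in> D. \<one> \<otimes> d \<in> D} = D"
    using ds by (auto simp: difference_set_def)
  then show ?thesis
    using ds by (simp add: difference_set_def)
qed

text \<open>The identity contributes \<open>k\<close> and every other element of \<open>S\<close>
  contributes \<open>l\<close>. Adding \<open>l\<close> on the left avoids the truncated subtraction
  in \<open>card S - 1\<close>.\<close>

lemma sum_card_difference_set_shift:
  fixes G (structure)
  assumes ds: "difference_set G v k l D" and S: "S \<subseteq> carrier G" "\<one> \<in> S"
  shows "(\<Sum>g\<in>S. card {d \<in> D. g \<otimes> d \<in> D}) + l = k + l * card S"
proof -
  have fin: "finite S"
    using ds S by (auto simp: difference_set_def intro: finite_subset)
  have "(\<Sum>g\<in>S. card {d \<in> D. g \<otimes> d \<in> D}) = k + (\<Sum>g\<in>S - {\<one>}. card {d \<in> D. g \<otimes> d \<in> D})"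
    using sum.remove[OF fin S(2), of "\<lambda>g. card {d \<in> D. g \<otimes> d \<in> D}"]
      card_difference_set_shift_one[OF ds] by simp
  also have "(\<Sum>g\<in>S - {\<one>}. card {d \<in> D. g \<otimes> d \<in> D}) = (\<Sum>g\<in>S - {\<one>}. l)"
    using S by (intro sum.cong refl card_difference_set_shift[OF ds]) auto
  also have "\<dots> = card (S - {\<one>}) * l"
    by simp
  also have "card (S - {\<one>}) = card S - 1"
    using fin S by simp
  finally show ?thesis
    using fin S card_gt_0_iff[of S] by (cases "card S") auto
qed

lemma card_difference_set_pairs:
  fixes G (structure)
  assumes ds: "difference_set G v k l D" and S: "S \<subseteq> carrier G" "\<one> \<in> S"
  shows "card {(c, d). c \<in> D \<and> d \<in> D \<and> c \<otimes> inv d \<in> S} + l = k + l * card S"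
proof -
  interpret comm_group G
    using ds by (simp add: difference_set_def)
  have D: "d \<in> carrier G" if "d \<in> D" for d
    using ds that by (auto simp: difference_set_def)
  have fin: "finite S" "finite D"
    using ds S by (auto simp: difference_set_def intro: finite_subset)
  have S': "g \<in> carrier G" if "g \<in> S" for g
    using that S by auto
  have "bij_betw (\<lambda>(g, d). (g \<otimes> d, d)) (SIGMA g:S. {d \<in> D. g \<otimes> d \<in> D})
      {(c, d). c \<in> D \<and> d \<in> D \<and> c \<otimes> inv d \<in> S}"
    by (rule bij_betw_byWitness[where f' = "\<lambda>(c, d). (c \<otimes> inv d, d)"])
      (use D S' in \<open>auto simp: m_assoc\<close>)
  then have "card {(c, d). c \<in> D \<and> d \<in> D \<and> c \<otimes> inv d \<in> S} =
      (\<Sum>g\<in>S. card {d \<in> D. g \<otimes> d \<in> D})"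
    using fin by (simp add: bij_betw_same_card[symmetric])
  then show ?thesis
    using sum_card_difference_set_shift[OF assms] by simp
qed

text \<open>This is the classical relation \<open>k * (k - 1) = l * (v - 1)\<close> without
  subtraction, from \<open>S = carrier G\<close>.\<close>

lemma difference_set_parameters:
  fixes G (structure)
  assumes ds: "difference_set G v k l D"
  shows "k * k + l = k + l * v"
proof -
  interpret comm_group G
    using ds by (simp add: difference_set_def)
  have D: "d \<in> carrier G" if "d \<in> D" for d
    using ds that by (auto simp: difference_set_def)
  have "{(c, d). c \<in> D \<and> d \<in> D \<and> c \<otimes> inv d \<in> carrier G} = D \<times> D"
    using D by auto
  then show ?thesis
    using card_difference_set_pairs[OF ds, of "carrier G"] ds
    by (simp add: card_cartesian_product difference_set_def order_def)
qed

lemma difference_set_translate: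
  fixes G (structure)
  assumes ds: "difference_set G v k l D" and y: "y \<in> carrier G"
  shows "difference_set G v k l (D #> y)"
proof -
  interpret comm_group G
    using ds by (simp add: difference_set_def)
  have D: "d \<in> carrier G" if "d \<in> D" for d
    using ds that by (auto simp: difference_set_def)
  have quot: "(c \<otimes> y) \<otimes> inv (d \<otimes> y) = c \<otimes> inv d" if "c \<in> D" "d \<in> D" for c d
    using D[OF that(1)] D[OF that(2)] y by (simp add: inv_mult_group m_assoc[symmetric]) (simp add: m_assoc)
  have inj: "inj_on (\<lambda>d. d \<otimes> y) D"
    using D y by (auto intro: inj_onI)
  have img: "D #> y = (\<lambda>d. d \<otimes> y) ` D"
    by (auto simp: r_coset_def)
  have "card {(c, d). c \<in> D #> y \<and> d \<in> D #> y \<and> c \<otimes> inv d = g} =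
      card {(c, d). c \<in> D \<and> d \<in> D \<and> c \<otimes> inv d = g}" for g
  proof -
    have "{(c, d). c \<in> D #> y \<and> d \<in> D #> y \<and> c \<otimes> inv d = g} =
        map_prod (\<lambda>d. d \<otimes> y) (\<lambda>d. d \<otimes> y) ` {(c, d). c \<in> D \<and> d \<in> D \<and> c \<otimes> inv d = g}"
      unfolding img using quot by (auto simp: image_iff)
    moreover have "inj_on (map_prod (\<lambda>d. d \<otimes> y) (\<lambda>d. d \<otimes> y))
        {(c, d). c \<in> D \<and> d \<in> D \<and> c \<otimes> inv d = g}"
      using inj by (auto simp: inj_on_def)
    ultimately show ?thesis
      by (simp add: card_image)
  qed
  then show ?thesis
    using ds y D inj by (auto simp: difference_set_def img card_image)
qed

section \<open>Existence of a fixed translate\<close>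

text \<open>
  An automorphism of a symmetric design fixes as many blocks as points: both sides of \<open>eq\<close> below
  count the pairs of a point \<open>x\<close> and a block containing both \<open>x\<close> and \<open>\<sigma> x\<close>.
\<close>

lemma difference_set_fixed_translate:
  fixes G (structure)
  assumes ds: "difference_set G v k l D" and "l < k"
    and hom: "\<sigma> \<in> hom G G" and inj: "inj_on \<sigma> (carrier G)"
    and g: "g \<in> carrier G" and img: "\<sigma> ` D = D #> g"
  shows "\<exists>y \<in> carrier G. \<sigma> ` (D #> y) = D #> y"
proof -
  interpret comm_group G
    using ds by (simp add: difference_set_def)
  interpret \<sigma>: group_hom G G \<sigma>
    using hom by unfold_locales
  have D: "d \<in> carrier G" if "d \<in> D" for d
    using ds that by (auto simp: difference_set_def)
  have fin: "finite (carrier G)" "finite D"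
    using ds by (auto simp: difference_set_def intro: finite_subset)
  define N where "N a = card {d \<in> D. a \<otimes> d \<in> D}" for a
  have N: "N a = (if a = \<one> then k else l)" if "a \<in> carrier G" for a
    using that card_difference_set_shift[OF ds] card_difference_set_shift_one[OF ds]
    by (simp add: N_def)
  \<comment> \<open>The pair \<open>(x, d)\<close> encodes the point
    \<open>x = d \<otimes> y\<close> of the block \<open>D #> y\<close> with
    \<open>y = inv d \<otimes> x\<close>; the condition on \<open>d\<close> says that
    \<open>\<sigma> x\<close> lies in this block too.\<close>
  have "bij_betw (\<lambda>(x, d). (inv d \<otimes> x, d))
      (SIGMA x:carrier G. {d \<in> D. (\<sigma> x \<otimes> inv x) \<otimes> d \<in> D})
      (SIGMA y:carrier G. {d \<in> D. \<sigma> (d \<otimes> y) \<otimes> inv y \<in> D})"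
  proof (rule bij_betw_byWitness[where f' = "\<lambda>(y, d). (d \<otimes> y, d)"], goal_cases)
    case 3
    have "\<sigma> (d \<otimes> (inv d \<otimes> x)) \<otimes> inv (inv d \<otimes> x) = (\<sigma> x \<otimes> inv x) \<otimes> d"
      if "d \<in> carrier G" "x \<in> carrier G" for d x
      using that by (simp add: m_assoc[symmetric] inv_mult_group del: \<sigma>.hom_mult)
    then show ?case
      using D by (auto simp del: \<sigma>.hom_mult)
  next
    case 4
    have "(\<sigma> (d \<otimes> y) \<otimes> inv (d \<otimes> y)) \<otimes> d = \<sigma> (d \<otimes> y) \<otimes> inv y"
      if "d \<in> carrier G" "y \<in> carrier G" for d y
      using that by (simp add: inv_mult_group m_assoc del: \<sigma>.hom_mult)
    then show ?case
      using D by (auto simp del: \<sigma>.hom_mult)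
  qed (use D in \<open>auto simp: m_assoc[symmetric]\<close>)
  then have "card (SIGMA x:carrier G. {d \<in> D. (\<sigma> x \<otimes> inv x) \<otimes> d \<in> D}) =
      card (SIGMA y:carrier G. {d \<in> D. \<sigma> (d \<otimes> y) \<otimes> inv y \<in> D})"
    by (rule bij_betw_same_card)
  then have "(\<Sum>x\<in>carrier G. N (\<sigma> x \<otimes> inv x)) =
      (\<Sum>y\<in>carrier G. card {d \<in> D. \<sigma> (d \<otimes> y) \<otimes> inv y \<in> D})"
    using fin by (simp add: N_def)
  \<comment> \<open>The image of the block \<open>D #> y\<close> is the block
    \<open>D #> (g \<otimes> \<sigma> y)\<close>, so the summand is the size of the intersection of
    two blocks.\<close>
  also have "\<dots> = (\<Sum>y\<in>carrier G. N (g \<otimes> \<sigma> y \<otimes> inv y))"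
  proof (rule sum.cong[OF refl])
    fix y assume y: "y \<in> carrier G"
    let ?a = "g \<otimes> \<sigma> y \<otimes> inv y"
    have eq: "c \<otimes> g \<otimes> \<sigma> y \<otimes> inv y = ?a \<otimes> c" if "c \<in> D" for c
      using D[OF that] y g by (simp add: m_ac)
    have "\<sigma> ` {d \<in> D. \<sigma> (d \<otimes> y) \<otimes> inv y \<in> D} =
        {s \<in> \<sigma> ` D. s \<otimes> \<sigma> y \<otimes> inv y \<in> D}"
      using D y by auto
    also have "\<dots> = (\<lambda>c. c \<otimes> g) ` {c \<in> D. ?a \<otimes> c \<in> D}"
      unfolding img using eq by (auto simp: r_coset_def)
    finally have image: "\<sigma> ` {d \<in> D. \<sigma> (d \<otimes> y) \<otimes> inv y \<in> D} =
        (\<lambda>c. c \<otimes> g) ` {c \<in> D. ?a \<otimes> c \<in> D}" .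
    have "card {d \<in> D. \<sigma> (d \<otimes> y) \<otimes> inv y \<in> D} =
        card (\<sigma> ` {d \<in> D. \<sigma> (d \<otimes> y) \<otimes> inv y \<in> D})"
      using inj D by (intro card_image[symmetric]) (auto intro: inj_on_subset)
    also have "\<dots> = N ?a"
      unfolding image N_def using D g by (intro card_image) (auto intro: inj_onI)
    finally show "card {d \<in> D. \<sigma> (d \<otimes> y) \<otimes> inv y \<in> D} = N ?a" .
  qed
  finally have eq: "(\<Sum>x\<in>carrier G. N (\<sigma> x \<otimes> inv x)) = (\<Sum>y\<in>carrier G. N (g \<otimes> \<sigma> y \<otimes> inv y))" .
  \<comment> \<open>Without a fixed block every summand on the right is \<open>l\<close>, while the
    fixed point \<open>\<one>\<close> contributes \<open>k > l\<close> on the left.\<close>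
  have "\<exists>y \<in> carrier G. g \<otimes> \<sigma> y \<otimes> inv y = \<one>"
  proof (rule ccontr)
    assume "\<not> ?thesis"
    then have "(\<Sum>y\<in>carrier G. N (g \<otimes> \<sigma> y \<otimes> inv y)) = (\<Sum>y\<in>carrier G. l)"
      using g by (intro sum.cong refl) (auto simp: N)
    moreover have "(\<Sum>y\<in>carrier G. l) < (\<Sum>x\<in>carrier G. N (\<sigma> x \<otimes> inv x))"
      using fin \<open>l < k\<close> by (intro sum_strict_mono_ex1) (auto simp: N intro!: bexI[of _ \<one>])
    ultimately show False
      using eq by simp
  qed
  then obtain y where y: "y \<in> carrier G" "g \<otimes> \<sigma> y \<otimes> inv y = \<one>"
    by blast
  then have gy: "g \<otimes> \<sigma> y = y"
    using g by (metis \<sigma>.hom_closed inv_closed inv_equality inv_inv m_closed)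
  have coset: "D #> c = (\<lambda>d. d \<otimes> c) ` D" for c
    by (auto simp: r_coset_def)
  have "\<sigma> ` (D #> y) = (\<lambda>s. s \<otimes> \<sigma> y) ` (\<sigma> ` D)"
    unfolding coset image_image using D y by (intro image_cong) auto
  also have "\<dots> = (\<lambda>d. d \<otimes> (g \<otimes> \<sigma> y)) ` D"
    unfolding img coset image_image using D g y by (intro image_cong) (auto simp: m_assoc)
  also have "\<dots> = D #> y"
    unfolding gy coset ..
  finally show ?thesis
    using y by blast
qed

section \<open>Difference sets stable under the twisted translation\<close>

text \<open>
  In the application \<open>r\<close> is the first coordinate on \<open>C\<^bsub>p^e\<^esub> \<times> H\<close>, \<open>z\<close> is the element
  \<open>(p^(e-1), 1)\<close>, and \<open>x \<mapsto> x \<otimes> z [^] r x\<close> is the power map \<open>x \<mapsto> x^t\<close>.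
\<close>

locale stable_difference_set = comm_group G for G (structure) +
  fixes v k l p :: nat and D :: "'a set" and r :: "'a \<Rightarrow> int" and z :: 'a
  assumes difference_set: "difference_set G v k l D"
    and prime: "prime p"
    and z_closed [simp]: "z \<in> carrier G" and z_neq_one: "z \<noteq> \<one>" and z_pow: "z [^] p = \<one>"
    and r_mult: "\<lbrakk>x \<in> carrier G; y \<in> carrier G\<rbrakk> \<Longrightarrow> [r (x \<otimes> y) = r x + r y] (mod int p)"
    and r_z: "int p dvd r z"
    and index: "p * card {x \<in> carrier G. int p dvd r x} = v"
    and stable: "d \<in> D \<Longrightarrow> d \<otimes> z [^] r d \<in> D"
    and small: "2 * k < v"
    and nontrivial: "l + 1 < k"
begin

definition K :: "'a set" where
  "K = {x \<in> carrier G. int p dvd r x}"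

lemma finite_carrier: "finite (carrier G)"
  using difference_set by (simp add: difference_set_def)

lemma D_closed [simp]: "d \<in> D \<Longrightarrow> d \<in> carrier G"
  using difference_set by (auto simp: difference_set_def)

lemma finite_D [simp]: "finite D"
  using finite_carrier D_closed by (metis finite_subset subsetI)

lemma card_D: "card D = k"
  using difference_set by (simp add: difference_set_def)

lemma K_closed [simp]: "x \<in> K \<Longrightarrow> x \<in> carrier G"
  by (simp add: K_def)

lemma finite_K [simp]: "finite K"
  using finite_carrier by (simp add: K_def del: K_closed)

lemma z_in_K: "z \<in> K"
  by (simp add: K_def r_z del: K_closed)

lemma one_in_K: "\<one> \<in> K"
  using r_mult[of \<one> \<one>] by (simp add: K_def cong_iff_dvd_diff del: K_closed)

lemma shift_in_K_iff:
  assumes "g \<in> K" and "x \<in> carrier G"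
  shows "g \<otimes> x \<in> K \<longleftrightarrow> x \<in> K"
proof -
  have "int p dvd r (g \<otimes> x) \<longleftrightarrow> int p dvd r g + r x"
    using assms by (intro cong_dvd_iff r_mult) auto
  also have "\<dots> \<longleftrightarrow> int p dvd r x"
    using assms by (intro dvd_add_right_iff) (simp add: K_def del: K_closed)
  finally show ?thesis
    using assms by (simp add: K_def del: K_closed)
qed

lemma quotient_in_K_iff:
  assumes "c \<in> carrier G" and "d \<in> carrier G"
  shows "c \<otimes> inv d \<in> K \<longleftrightarrow> r c mod int p = r d mod int p"
proof -
  have "[r c = r (c \<otimes> inv d) + r d] (mod int p)"
    using r_mult[of "c \<otimes> inv d" d] assms by (simp add: m_assoc)
  then have "[r c = r d] (mod int p) \<longleftrightarrow> [r (c \<otimes> inv d) + r d = 0 + r d] (mod int p)"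
    by (metis add_0 cong_sym cong_trans)
  also have "\<dots> \<longleftrightarrow> [r (c \<otimes> inv d) = 0] (mod int p)"
    by (rule cong_add_rcancel)
  finally show ?thesis
    using assms by (simp add: K_def cong_def dvd_eq_mod_eq_0 del: K_closed)
qed

lemma z_pow_cong:
  assumes "[i = j] (mod int p)"
  shows "z [^] i = z [^] j"
proof -
  have "ord z dvd p"
    using z_pow by (simp add: pow_eq_id)
  then have "int (ord z) dvd j - i"
    using assms by (meson cong_iff_dvd_diff cong_sym dvd_trans int_dvd_int_iff)
  then show ?thesis
    by (simp add: int_pow_eq)
qed

lemma z_int_pow_in_K: "z [^] (i::int) \<in> K"
proof -
  have nat: "z [^] n \<in> K" for n :: nat
    by (induction n) (auto simp: one_in_K z_in_K shift_in_K_iff)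
  have "z [^] i = z [^] int (nat (i mod int p))"
    using prime_gt_0_nat[OF prime] by (intro z_pow_cong) (simp add: cong_def)
  then show ?thesis
    using nat by (simp only: int_pow_int)
qed

text \<open>Multiplying by powers of \<open>z\<close> preserves \<open>r\<close> modulo
  \<open>p\<close>, so \<open>m\<close> applications of \<open>stable\<close> multiply
  \<open>d\<close> by \<open>z [^] (r d * m)\<close>. Outside \<open>K\<close> the residue
  \<open>r d\<close> is invertible, and its inverse serves as \<open>m\<close>.\<close>

lemma shift_outside_K:
  assumes d: "d \<in> D" "d \<notin> K"
  shows "z \<otimes> d \<in> D"
proof -
  have iter: "d \<otimes> z [^] (r d * int m) \<in> D" for m
  proof (induction m)
    case 0
    then show ?case using d by simp
  next
    case (Suc m)
    let ?c = "d \<otimes> z [^] (r d * int m)"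
    have "[r ?c = r d + r (z [^] (r d * int m))] (mod int p)"
      using d by (intro r_mult) auto
    then have "[r ?c = r d] (mod int p)"
      using z_int_pow_in_K[of "r d * int m"]
      by (metis (no_types, lifting) K_def add.right_neutral cong_0_iff cong_add_lcancel cong_trans
          mem_Collect_eq)
    then have "?c \<otimes> z [^] r d \<in> D"
      using stable[OF Suc] z_pow_cong by metis
    then show ?case
      using d by (simp add: m_assoc int_pow_mult[symmetric] algebra_simps)
  qed
  have "coprime (int p) (r d)"
    using d prime by (intro prime_imp_coprime) (auto simp: K_def simp del: K_closed)
  then obtain m where m: "[r d * m = 1] (mod int p)"
    using cong_solve_coprime_int[of "r d" "int p"] by (auto simp: coprime_commute)
  have "[r d * int (nat (m mod int p)) = 1] (mod int p)"
    using m prime_gt_0_nat[OF prime] by (simp add: cong_def mod_mult_right_eq)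
  then have "z [^] (r d * int (nat (m mod int p))) = z"
    using z_pow_cong by fastforce
  then show ?thesis
    using iter[of "nat (m mod int p)"] d by (simp add: m_comm)
qed

section \<open>Bounds on the part of the difference set inside \<open>K\<close>\<close>

lemma card_D_split: "card (D \<inter> K) + card (D - K) = k"
  using card_D card_Int_Diff[of D K] by simp

lemma card_shift_z: "card (D - K) + card {d \<in> D \<inter> K. z \<otimes> d \<in> D} = l"
proof -
  have "{d \<in> D. z \<otimes> d \<in> D} = (D - K) \<union> {d \<in> D \<inter> K. z \<otimes> d \<in> D}"
    using shift_outside_K by auto
  then have "card {d \<in> D. z \<otimes> d \<in> D} = card (D - K) + card {d \<in> D \<inter> K. z \<otimes> d \<in> D}"
    by (simp only:) (auto intro!: card_Un_disjoint)
  then show ?thesis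
    using card_difference_set_shift[OF difference_set z_closed z_neq_one] by simp
qed

lemma card_D_Int_K_ge: "k \<le> card (D \<inter> K) + l"
  using card_D_split card_shift_z by simp

text \<open>The \<open>k - l\<close> elements of \<open>D\<close> that \<open>z\<close> moves out of
  \<open>D\<close> all lie in \<open>K\<close>, and \<open>z\<close> sends them injectively into
  \<open>K - D\<close>.\<close>

lemma card_D_Int_K_le: "card (D \<inter> K) + k \<le> card K + l"
proof -
  have "card {d \<in> D \<inter> K. z \<otimes> d \<notin> D} \<le> card (K - D)"
    by (rule card_inj_on_le[of "\<lambda>d. z \<otimes> d"])
      (auto simp: shift_in_K_iff z_in_K intro!: inj_onI)
  also have "\<dots> = card K - card (D \<inter> K)"
    by (simp add: card_Diff_subset_Int Int_commute)
  moreover have "card (D \<inter> K) \<le> card K"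
    by (intro card_mono) auto
  moreover have "card (D \<inter> K) =
      card {d \<in> D \<inter> K. z \<otimes> d \<in> D} + card {d \<in> D \<inter> K. z \<otimes> d \<notin> D}"
    by (subst card_Un_disjoint[symmetric]) (auto intro: arg_cong[of _ _ card])
  ultimately show ?thesis
    using card_D_split card_shift_z by linarith
qed

lemma card_K: "p * card K = v"
  using index by (simp add: K_def del: K_closed)

text \<open>
  Cauchy--Schwarz over the nontrivial cosets of \<open>K\<close>, applied to the number of pairs of elements
  of \<open>D\<close> whose quotient lies in \<open>K\<close>.
\<close>

lemma card_D_Int_K_deviation:
  "(int p * int (card (D \<inter> K)) - int k)\<^sup>2 \<le> (int p - 1)\<^sup>2 * (int k - int l)"
proof -
  define F where "F i = {d \<in> D. r d mod int p = i}" for i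
  have p0: "0 < int p"
    using prime_gt_0_nat[OF prime] by simp
  have fin: "finite (F i)" for i
    by (simp add: F_def)
  have F0: "F 0 = D \<inter> K"
    by (auto simp: F_def K_def simp del: K_closed)
  have ivl: "{0..<int p} = insert 0 {1..<int p}"
    using p0 by auto
  have "D = (\<Union>i\<in>{0..<int p}. F i)"
    using p0 by (auto simp: F_def)
  then have "card D = (\<Sum>i\<in>{0..<int p}. card (F i))"
    using fin by (simp only:) (rule card_UN_disjoint, auto simp: F_def)
  then have sum: "k = card (D \<inter> K) + (\<Sum>i\<in>{1..<int p}. card (F i))"
    by (simp add: ivl card_D F0)
  have "{(c, d). c \<in> D \<and> d \<in> D \<and> c \<otimes> inv d \<in> K} = (\<Union>i\<in>{0..<int p}. F i \<times> F i)"
    using p0 by (auto simp: F_def quotient_in_K_iff)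
  then have "card {(c, d). c \<in> D \<and> d \<in> D \<and> c \<otimes> inv d \<in> K} =
      (\<Sum>i\<in>{0..<int p}. card (F i \<times> F i))"
    using fin by (simp only:) (rule card_UN_disjoint, auto simp: F_def)
  also have "\<dots> = (\<Sum>i\<in>{0..<int p}. (card (F i))\<^sup>2)"
    by (simp add: card_cartesian_product power2_eq_square)
  finally have squares:
    "(card (D \<inter> K))\<^sup>2 + (\<Sum>i\<in>{1..<int p}. (card (F i))\<^sup>2) + l = k + l * card K"
    using card_difference_set_pairs[OF difference_set, of K] one_in_K
    by (force simp: ivl F0)
  define P a kk ll n w S where "P = real p" and "a = real (card (D \<inter> K))" and "kk = real k"
    and "ll = real l" and "n = kk - ll" and "w = real (card K)"
    and "S = (\<Sum>i\<in>{1..<int p}. (real (card (F i)))\<^sup>2)"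
  have P: "P \<ge> 1"
    using p0 by (simp add: P_def)
  have "real k = real (card (D \<inter> K)) + (\<Sum>i\<in>{1..<int p}. real (card (F i)))"
    by (subst sum) simp
  then have "(kk - a)\<^sup>2 = (\<Sum>i\<in>{1..<int p}. real (card (F i)))\<^sup>2"
    by (simp add: kk_def a_def)
  also have "\<dots> \<le> S * real (card {1..<int p})"
    unfolding S_def by (rule sum_squared_le_sum_of_squares)
  also have "real (card {1..<int p}) = P - 1"
    using p0 by (simp add: P_def)
  finally have CS: "(kk - a)\<^sup>2 \<le> S * (P - 1)" .
  have "real ((card (D \<inter> K))\<^sup>2 + (\<Sum>i\<in>{1..<int p}. (card (F i))\<^sup>2) + l) = real (k + l * card K)"
    by (simp only: squares)
  then have S: "S = n + ll * w - a\<^sup>2"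
    by (simp add: S_def n_def kk_def ll_def w_def a_def)
  have "real (k * k + l) = real (k + l * (p * card K))"
    using difference_set_parameters[OF difference_set] by (simp only: card_K)
  then have par: "kk\<^sup>2 = n + ll * (P * w)"
    by (simp add: n_def kk_def ll_def w_def P_def power2_eq_square)
  \<comment> \<open>The factor \<open>P\<close> turns \<open>ll * w\<close> into
    \<open>ll * (P * w)\<close>, which \<open>par\<close> expresses by \<open>kk\<close> and
    \<open>n\<close> alone.\<close>
  have "P * (kk - a)\<^sup>2 \<le> P * (S * (P - 1))"
    using CS P by (intro mult_left_mono) auto
  also have "\<dots> = (P - 1) * (P * n + ll * (P * w) - P * a\<^sup>2)"
    unfolding S by (simp add: algebra_simps)
  also have "\<dots> = (P - 1) * (P * n + (kk\<^sup>2 - n) - P * a\<^sup>2)"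
    using par by simp
  finally have "(P * a - kk)\<^sup>2 \<le> (P - 1)\<^sup>2 * n"
    by (simp add: power2_eq_square algebra_simps)
  then have "real_of_int ((int p * int (card (D \<inter> K)) - int k)\<^sup>2)
      \<le> real_of_int ((int p - 1)\<^sup>2 * (int k - int l))"
    by (simp add: P_def a_def kk_def n_def ll_def)
  then show ?thesis
    by (simp only: of_int_le_iff)
qed

section \<open>Reduction to Hadamard parameters\<close>

text \<open>Insert \<open>v \<ge> 2 * k + 1\<close> into the parameter equation and cancel
  \<open>k\<close>. Equivalently, \<open>k\<close> is less than twice the order
  \<open>k - l\<close>.\<close>

lemma two_l_less: "2 * l < k"
proof -
  have "k * k + l = k + l * v"
    by (rule difference_set_parameters[OF difference_set])
  moreover have "l * (2 * k + 1) \<le> l * v"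
    using small by (intro mult_left_mono) auto
  ultimately have "k * (2 * l + 1) \<le> k * k"
    by (simp add: algebra_simps)
  then have "2 * l + 1 \<le> k"
    using nontrivial by (subst (asm) mult_le_cancel1) simp
  then show ?thesis
    by simp
qed

lemma p_eq_two: "p = 2"
proof (rule ccontr)
  assume "p \<noteq> 2"
  then have p: "int p \<ge> 3"
    using prime_ge_2_nat[OF prime] by simp
  define q n a where "q = int p - 2" and "n = int k - int l" and "a = int (card (D \<inter> K))"
  have q: "q \<ge> 1" and n: "n \<ge> 2"
    using p nontrivial by (simp_all add: q_def n_def)
  have "int p * n \<le> int p * a"
    using card_D_Int_K_ge by (intro mult_left_mono) (auto simp: n_def a_def)
  then have "q * n + 1 \<le> int p * a - int k"
    using two_l_less by (simp add: q_def n_def algebra_simps)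
  moreover have "0 \<le> q * n + 1"
    using q n by simp
  ultimately have "(q * n + 1)\<^sup>2 \<le> (int p * a - int k)\<^sup>2"
    by (intro power_mono)
  also have "\<dots> \<le> (q + 1)\<^sup>2 * n"
    using card_D_Int_K_deviation by (simp add: q_def n_def a_def)
  \<comment> \<open>The cross terms \<open>2 * q * n\<close> cancel and the remaining difference
    factors.\<close>
  finally have "(n - 1) * (q * q * n - 1) \<le> 0"
    by (simp add: power2_eq_square algebra_simps)
  moreover have "1 * 1 \<le> q * q"
    using q by (intro mult_mono) auto
  then have "1 * 2 \<le> (q * q) * n"
    using n by (intro mult_mono) auto
  then have "0 < (n - 1) * (q * q * n - 1)"
    using n by simp
  ultimately show False
    by simp
qed

text \<open>With \<open>n\<close> the order and \<open>j = 2 * n - k\<close>, the lower bound on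
  \<open>D \<inter> K\<close> and the deviation bound give \<open>j\<^sup>2 \<le> n\<close>. Both
  bounds on \<open>D \<inter> K\<close> give \<open>v \<ge> 4 * n\<close>, and then the parameter
  equation gives \<open>n \<le> j\<^sup>2\<close>. Equality holds throughout, and \<open>u\<close>
  is \<open>j\<close>.\<close>

lemma extremal:
  obtains u :: nat where "u \<ge> 2" "k = l + u\<^sup>2" "k + u = 2 * u\<^sup>2" "v = 4 * u\<^sup>2" "card (D \<inter> K) = u\<^sup>2"
proof -
  define n a j w where "n = int k - int l" and "a = int (card (D \<inter> K))"
    and "j = int k - 2 * int l" and "w = int (card K)"
  have l: "int l = n - j" and k: "int k = 2 * n - j" and v: "int v = 2 * w"
    using card_K by (auto simp: n_def j_def w_def p_eq_two)
  have j: "j \<ge> 1" and n: "n \<ge> 2" and ln: "0 \<le> n - j"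
    using two_l_less nontrivial by (auto simp: j_def n_def)
  have an: "n \<le> a" and aw: "a + n \<le> w"
    using card_D_Int_K_ge card_D_Int_K_le by (auto simp: n_def a_def w_def)
  have dev: "(2 * a - int k)\<^sup>2 \<le> n"
    using card_D_Int_K_deviation by (simp add: p_eq_two n_def a_def)
  have ja: "j \<le> 2 * a - int k"
    using an k by simp
  have "j\<^sup>2 \<le> (2 * a - int k)\<^sup>2"
    using ja j by (intro power_mono) auto
  with dev have jn: "j\<^sup>2 \<le> n"
    by simp
  have "int (k * k + l) = int (k + l * v)"
    by (simp only: difference_set_parameters[OF difference_set])
  then have par: "(2 * n - j) * (2 * n - j) + (n - j) = (2 * n - j) + (n - j) * int v"
    by (simp only: of_nat_add of_nat_mult l k)
  have "(n - j) * (4 * n) \<le> (n - j) * int v"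
    using ln an aw v by (intro mult_left_mono) auto
  with par have "n \<le> j\<^sup>2"
    by (simp add: power2_eq_square algebra_simps)
  with jn have nj: "n = j\<^sup>2"
    by simp
  \<comment> \<open>Nontriviality excludes \<open>j = 1\<close>, so \<open>n - j\<close>, which is
    \<open>l\<close>, is nonzero and cancels from the parameter equation.\<close>
  have j2: "j \<ge> 2"
    using n nj j by (cases "j = 1") auto
  then have "j * 1 < j * j"
    by (intro mult_strict_left_mono) auto
  then have "n - j \<noteq> 0"
    unfolding nj power2_eq_square by linarith
  moreover have "(n - j) * int v = (n - j) * (4 * n)"
    using par by (simp add: nj power2_eq_square algebra_simps)
  ultimately have v4: "int v = 4 * n"
    by simp
  have "(2 * a - int k)\<^sup>2 \<le> j\<^sup>2"
    using dev nj by simp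
  then have "2 * a - int k \<le> j"
    using j by (simp add: power2_le_iff_abs_le)
  with ja k have a: "a = n"
    by simp
  define u where "u = nat j"
  have u: "int u = j"
    using j by (simp add: u_def)
  have "int k = int (l + u\<^sup>2)" "int (k + u) = int (2 * u\<^sup>2)" "int v = int (4 * u\<^sup>2)"
    "int (card (D \<inter> K)) = int (u\<^sup>2)"
    using k l v4 a by (simp_all add: u nj a_def)
  note eqs = this[unfolded of_nat_eq_iff]
  show thesis
  proof
    show "u \<ge> 2"
      using j2 u by simp
    show "k = l + u\<^sup>2" "k + u = 2 * u\<^sup>2" "v = 4 * u\<^sup>2" "card (D \<inter> K) = u\<^sup>2"
      by (fact eqs)+
  qed
qed

lemma hadamard: "hadamard_parameters v k l"
proof -
  obtain u :: nat where "u \<ge> 2" "k = l + u\<^sup>2" "k + u = 2 * u\<^sup>2" "v = 4 * u\<^sup>2"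
    by (rule extremal)
  then show ?thesis
    unfolding hadamard_parameters_def by (intro exI[of _ u]) auto
qed

section \<open>The cyclic case\<close>

lemma not_cyclic: "\<not> cyclic_group G"
proof
  assume "cyclic_group G"
  then obtain x where x: "x \<in> carrier G" "subgroup_generated G {x} = G"
    by (auto simp: cyclic_group_def)
  obtain u :: nat where u: "u \<ge> 2" "k = l + u\<^sup>2" "v = 4 * u\<^sup>2" "card (D \<inter> K) = u\<^sup>2"
    by (rule extremal)
  define n where "n = u\<^sup>2"
  have "2 * 2 \<le> u * u"
    using u by (intro mult_mono) auto
  then have n: "n \<ge> 4" "k = l + n" "v = 4 * n" "card (D \<inter> K) = n"
    using u by (auto simp: n_def power2_eq_square)
  have cardK: "card K = 2 * n"
    using card_K n by (simp add: p_eq_two)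
  have zz: "z \<otimes> (z \<otimes> c) = c" if "c \<in> carrier G" for c
    using z_pow that by (simp add: p_eq_two m_assoc[symmetric] numeral_2_eq_2)
  have zz1: "z \<otimes> z = \<one>"
    using zz[of \<one>] by simp
  \<comment> \<open>In the extremal case \<open>D - K\<close> has exactly \<open>l\<close> elements,
    which already account for all \<open>l\<close> elements that \<open>z\<close> keeps in
    \<open>D\<close>.\<close>
  have "card {d \<in> D \<inter> K. z \<otimes> d \<in> D} = 0"
    using card_shift_z card_D_split n by simp
  then have no_shift: "z \<otimes> d \<notin> D" if "d \<in> D" "d \<in> K" for d
    using that by auto
  have "(D \<inter> K) \<union> (\<lambda>d. z \<otimes> d) ` (D \<inter> K) = K"
  proof (rule card_subset_eq)
    show "(D \<inter> K) \<union> (\<lambda>d. z \<otimes> d) ` (D \<inter> K) \<subseteq> K"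
      using z_in_K by (auto simp: shift_in_K_iff)
    have "card ((\<lambda>d. z \<otimes> d) ` (D \<inter> K)) = card (D \<inter> K)"
      by (intro card_image inj_onI) auto
    then show "card ((D \<inter> K) \<union> (\<lambda>d. z \<otimes> d) ` (D \<inter> K)) = card K"
      using no_shift n cardK by (subst card_Un_disjoint) auto
  qed simp
  then have "c \<in> D \<or> (\<exists>d \<in> D. c = z \<otimes> d)" if "c \<in> K" for c
    using that by blast
  then have shift_iff: "z \<otimes> c \<in> D \<longleftrightarrow> c \<notin> D" if "c \<in> K" for c
    using that no_shift zz D_closed by metis
  \<comment> \<open>As \<open>D - K\<close> is invariant under \<open>z\<close>, the shifts by
    \<open>g\<close> and \<open>z \<otimes> g\<close> keep equally many of its elements in
    \<open>D\<close>. Both totals are \<open>l\<close>, so the counts on \<open>D \<inter> K\<close>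
    agree as well; there \<open>shift_iff\<close> makes them complementary.\<close>
  have half: "n = 2 * card {d \<in> D \<inter> K. g \<otimes> d \<notin> D}" if g: "g \<in> K" "g \<noteq> \<one>" "g \<noteq> z" for g
  proof -
    have split: "card {d \<in> D \<inter> K. h \<otimes> d \<in> D} + card {d \<in> D - K. h \<otimes> d \<in> D} = l"
      if "h \<in> carrier G" "h \<noteq> \<one>" for h
      using card_difference_set_shift[OF difference_set that]
      by (subst card_Un_disjoint[symmetric]) (auto intro: arg_cong[of _ _ card])
    have gd: "z \<otimes> g \<otimes> d = z \<otimes> (g \<otimes> d)" if "d \<in> D" for d
      using g that by (simp add: m_assoc)
    have "z \<otimes> g \<noteq> \<one>"
      using g zz[of g] by (metis K_closed r_one z_closed)
    moreover have "{d \<in> D - K. z \<otimes> g \<otimes> d \<in> D} = {d \<in> D - K. g \<otimes> d \<in> D}"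
    proof -
      have "z \<otimes> c \<in> D \<longleftrightarrow> c \<in> D" if "c \<in> carrier G" "c \<notin> K" for c
        using that shift_outside_K zz z_in_K by (metis m_closed shift_in_K_iff z_closed)
      then show ?thesis
        using g gd by (auto simp: shift_in_K_iff)
    qed
    ultimately have "card {d \<in> D \<inter> K. z \<otimes> g \<otimes> d \<in> D} = card {d \<in> D \<inter> K. g \<otimes> d \<in> D}"
      using split[of g] split[of "z \<otimes> g"] g by simp
    moreover have "{d \<in> D \<inter> K. z \<otimes> g \<otimes> d \<in> D} = {d \<in> D \<inter> K. g \<otimes> d \<notin> D}"
      using g gd shift_iff by (auto simp: shift_in_K_iff)
    moreover have "n = card {d \<in> D \<inter> K. g \<otimes> d \<in> D} + card {d \<in> D \<inter> K. g \<otimes> d \<notin> D}"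
      unfolding n(4)[symmetric]
      by (subst card_Un_disjoint[symmetric]) (auto intro: arg_cong[of _ _ card])
    ultimately show ?thesis
      by simp
  qed
  \<comment> \<open>The square of the generator \<open>x\<close> has order
    \<open>2 * n = card K\<close> and lies in \<open>K\<close> since \<open>p = 2\<close>, so it
    generates \<open>K\<close>.\<close>
  define y where "y = x [^] (2::nat)"
  have "ord x = 4 * n"
    using cyclic_order_is_ord[OF x(1)] x(2) difference_set n by (simp add: difference_set_def)
  then have ord_y: "ord y = 2 * n"
    unfolding y_def using x by (subst ord_pow) auto
  have "int p dvd r (x \<otimes> x) \<longleftrightarrow> int p dvd r x + r x"
    using x by (intro cong_dvd_iff r_mult)
  then have "int p dvd r (x \<otimes> x)"
    by (simp add: p_eq_two)
  then have y: "y \<in> K"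
    using x by (simp add: K_def y_def numeral_2_eq_2 del: K_closed)
  have y_pow: "y [^] i \<in> K" for i :: nat
    using y by (induction i) (auto simp: one_in_K shift_in_K_iff)
  have "{0..ord y - 1} = {..<2 * n}"
    using n ord_y by auto
  then have inj: "inj_on (\<lambda>i. y [^] i) {..<2 * n}"
    using ord_inj[of y] y by simp
  have image: "(\<lambda>i. y [^] i) ` {..<2 * n} = K"
    using y_pow cardK by (intro card_subset_eq) (auto simp: card_image[OF inj])
  \<comment> \<open>As an involution in the cyclic group \<open>K\<close>, \<open>z\<close> can only
    be \<open>y [^] n\<close>; hence the sequence \<open>b\<close> below is negated by a shift of
    \<open>n\<close>.\<close>
  have "z \<in> (\<lambda>i. y [^] i) ` {..<2 * n}"
    using z_in_K by (simp only: image)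
  then obtain i where i: "i < 2 * n" "y [^] i = z"
    by auto
  have "y [^] (i + i) = \<one>"
    using i zz1 y by (simp add: nat_pow_mult[symmetric])
  then have "2 * n dvd i + i"
    using y ord_y by (simp add: pow_eq_id)
  then have "n dvd i"
    by (simp flip: mult_2)
  moreover have "i \<noteq> 0"
    using i z_neq_one by (metis nat_pow_0)
  ultimately have "i = n"
    using i by (auto elim!: dvdE)
  then have yn: "y [^] n = z"
    using i by simp
  define b where "b i = (y [^] i \<in> D)" for i :: nat
  have b_add: "b (i + n) \<longleftrightarrow> \<not> b i" for i
    using shift_iff[OF y_pow[of i]] y by (simp add: b_def yn nat_pow_mult[symmetric] m_comm)
  have "y \<noteq> \<one>"
    using ord_y n ord_eq_1[of y] y by auto
  moreover have "y \<noteq> z"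
    using zz1 y ord_y n pow_eq_id[of y 2] by (auto simp: numeral_2_eq_2 dest: dvd_imp_le)
  ultimately have "n = 2 * card {d \<in> D \<inter> K. y \<otimes> d \<notin> D}"
    using half y by blast
  also have "{d \<in> D \<inter> K. y \<otimes> d \<notin> D} =
      {d \<in> (\<lambda>i. y [^] i) ` {..<2 * n}. d \<in> D \<and> y \<otimes> d \<notin> D}"
    unfolding image by auto
  also have "\<dots> = (\<lambda>i. y [^] i) ` {i. i < 2 * n \<and> b i \<and> \<not> b (Suc i)}"
  proof -
    have "y \<otimes> y [^] i = y [^] Suc i" for i
      using y by (simp add: m_comm)
    then show ?thesis
      by (auto simp only: b_def)
  qed
  also have "card \<dots> = card {i. i < 2 * n \<and> b i \<and> \<not> b (Suc i)}"
    by (intro card_image inj_on_subset[OF inj]) auto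
  \<comment> \<open>By \<open>b_add\<close>, a drop of \<open>b\<close> in the second half of the
    period is a rise in the first half. The drops over the full period thus count all changes in the
    first half.\<close>
  also have "{i. i < 2 * n \<and> b i \<and> \<not> b (Suc i)} =
      {i. i < n \<and> b i \<and> \<not> b (Suc i)} \<union> (\<lambda>i. i + n) ` {i. i < n \<and> \<not> b i \<and> b (Suc i)}"
  proof -
    have b_Suc_add: "b (Suc (i + n)) \<longleftrightarrow> \<not> b (Suc i)" for i
      using b_add[of "Suc i"] by simp
    have "\<exists>j. i = j + n \<and> j < n" if "i < 2 * n" "\<not> i < n" for i
      using that by (intro exI[of _ "i - n"]) auto
    then show ?thesis
      by (fastforce simp: b_add b_Suc_add)
  qed
  also have "card \<dots> = card {i. i < n \<and> b i \<and> \<not> b (Suc i)} + card {i. i < n \<and> \<not> b i \<and> b (Suc i)}"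
    by (subst card_Un_disjoint) (auto simp: card_image)
  also have "\<dots> = card {i. i < n \<and> b i \<noteq> b (Suc i)}"
    by (subst card_Un_disjoint[symmetric]) (auto intro: arg_cong[of _ _ card])
  \<comment> \<open>Along the powers of \<open>y\<close>, membership in \<open>D\<close> changes \<open>n / 2\<close> times on the way from \<open>0\<close> to \<open>n\<close>;
    this number is odd since \<open>b n \<noteq> b 0\<close>, and even since \<open>n = u\<^sup>2\<close>.\<close>
  finally have n_eq: "n = 2 * card {i. i < n \<and> b i \<noteq> b (Suc i)}" .
  have "odd (card {i. i < n \<and> b i \<noteq> b (Suc i)})"
    using b_add[of 0] card_changes_odd_iff[of n b] by simp
  moreover have "even u"
    using n_eq by (metis dvd_triv_left even_power n_def)
  then have "4 dvd n"
    by (auto simp: n_def power2_eq_square elim!: evenE)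
  then have "even (card {i. i < n \<and> b i \<noteq> b (Suc i)})"
    using n_eq by presburger
  ultimately show False
    by blast
qed

end


section \<open>Application to the power map on the direct product\<close>

theorem theorem1:
  fixes p e v k l :: nat and t :: int
    and H :: "('h, 'm) monoid_scheme" and P :: "'h set"
    and G :: "(int \<times> 'h) monoid" and D :: "(int \<times> 'h) set"
  assumes "prime p" and "e \<ge> 2"
    and "comm_group H" and "finite (carrier H)"
    and "sylow_subgroup p P H" and "group_exponent (H\<lparr>carrier := P\<rparr>) < p ^ e"
    and "G = integer_mod_group (p ^ e) \<times>\<times> H"
    and "[t = 1 + int p ^ (e - 1)] (mod (int p ^ e))"
    and "[t = 1] (mod (int (group_exponent H)))"
    and "difference_set G v k l D"
    and "2 * k < v"
    and "int k - int l > 1"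
    and "\<not> (p = 2 \<and> hadamard_parameters v k l \<and> \<not> cyclic_group G)"
  shows "\<not> multiplier G D t"
proof
  assume "multiplier G D t"
  then obtain g where coprime: "coprime t (int (order G))" and g: "g \<in> carrier G"
    and img: "(\<lambda>d. d [^]\<^bsub>G\<^esub> t) ` D = D #>\<^bsub>G\<^esub> g"
    by (auto simp: multiplier_def)
  interpret H: comm_group H
    by fact
  interpret G: comm_group G
    using assms(10) by (simp add: difference_set_def)
  have p: "p > 1"
    using prime_gt_1_nat assms(1) .
  define q where "q = p ^ e"
  have q: "0 < int q" "int q = int p ^ e"
    using p by (simp_all add: q_def)
  obtain f where f: "e = Suc f" "f \<ge> 1"
    using assms(2) by (cases e) auto
  have qf: "int q = int p * int p ^ f"
    by (simp add: q f)
  have p_dvd_q: "int p dvd int q"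
    by (simp add: qf)
  define z where "z = (int p ^ f, \<one>\<^bsub>H\<^esub>)"
  have carrier: "carrier G = {0..<int q} \<times> carrier H"
    using p by (simp add: assms(7) DirProd_def carrier_integer_mod_group q_def)
  have mult: "(a, h) \<otimes>\<^bsub>G\<^esub> (b, h') = ((a + b) mod int q, h \<otimes>\<^bsub>H\<^esub> h')" for a b h h'
    by (simp add: assms(7) q_def)
  have one: "\<one>\<^bsub>G\<^esub> = (0, \<one>\<^bsub>H\<^esub>)"
    by (simp add: assms(7))
  have pow: "(a, h) [^]\<^bsub>G\<^esub> i = (i * a mod int q, h [^]\<^bsub>H\<^esub> i)"
    if "(a, h) \<in> carrier G" for a h and i :: int
    using that unfolding carrier assms(7)
    by (subst int_pow_DirProd)
      (auto simp: q_def int_pow_integer_mod_group carrier_integer_mod_group)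
  have "int p ^ f < int p ^ e"
    using p by (simp add: f)
  then have z: "z \<in> carrier G"
    by (simp add: z_def carrier q)
  have z_neq: "z \<noteq> \<one>\<^bsub>G\<^esub>"
    using p by (simp add: z_def one)
  have z_pow: "z [^]\<^bsub>G\<^esub> p = \<one>\<^bsub>G\<^esub>"
    using pow[of "int p ^ f" "\<one>\<^bsub>H\<^esub>" "int p"] z
    by (simp add: z_def one qf int_pow_int)
  \<comment> \<open>Since \<open>t\<close> is 1 modulo the exponent of \<open>H\<close>, the second
    coordinate is fixed; the first coordinate \<open>a\<close> gains \<open>a * p ^ f\<close>, which
    is the first coordinate of \<open>z [^] a\<close>.\<close>
  have twist: "x [^]\<^bsub>G\<^esub> t = x \<otimes>\<^bsub>G\<^esub> z [^]\<^bsub>G\<^esub> fst x" if x: "x \<in> carrier G" for x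
  proof -
    obtain a h where ah: "x = (a, h)" and h: "h \<in> carrier H"
      using x by (auto simp: carrier)
    obtain m where "t - 1 = int (group_exponent H) * m"
      using assms(9) by (auto simp: cong_iff_dvd_diff)
    then have "t = 1 + int (group_exponent H) * m"
      by simp
    then have "h [^]\<^bsub>H\<^esub> t = h"
      using h H.pow_group_exponent[OF assms(4) h]
      by (simp add: H.int_pow_mult H.int_pow_pow[symmetric] int_pow_int)
    moreover have "[t * a = (1 + int p ^ f) * a] (mod int q)"
      using assms(8) by (intro cong_mult) (simp_all add: f q)
    then have "t * a mod int q = (a + a * int p ^ f mod int q) mod int q"
      by (simp add: cong_def algebra_simps mod_add_right_eq)
    ultimately show ?thesis
      using x z h by (simp add: ah z_def pow mult)
  qed
  have "inj_on (\<lambda>x. x [^]\<^bsub>G\<^esub> t) (carrier G)"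
  proof -
    obtain b c where bc: "t * b + int (order G) * c = 1"
      using coprime bezout_int[of t "int (order G)"] by (auto simp: algebra_simps)
    have "(x [^]\<^bsub>G\<^esub> t) [^]\<^bsub>G\<^esub> b = x" if x: "x \<in> carrier G" for x
    proof -
      have "x = x [^]\<^bsub>G\<^esub> (t * b + int (order G) * c)"
        using x bc by simp
      also have "\<dots> = x [^]\<^bsub>G\<^esub> (t * b) \<otimes>\<^bsub>G\<^esub> x [^]\<^bsub>G\<^esub> (int (order G) * c)"
        using x by (simp add: G.int_pow_mult)
      also have "x [^]\<^bsub>G\<^esub> (int (order G) * c) = \<one>\<^bsub>G\<^esub>"
        using x by (simp add: G.int_pow_pow[symmetric] int_pow_int G.pow_order_eq_1)
      finally show ?thesis
        using x by (simp add: G.int_pow_pow)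
    qed
    then show ?thesis
      by (rule inj_on_inverseI)
  qed
  moreover have "(\<lambda>x. x [^]\<^bsub>G\<^esub> t) \<in> hom G G"
    by (auto simp: hom_def G.int_pow_distrib)
  moreover have "l < k"
    using assms(12) by simp
  ultimately obtain y where y: "y \<in> carrier G"
    and fixed: "(\<lambda>x. x [^]\<^bsub>G\<^esub> t) ` (D #>\<^bsub>G\<^esub> y) = D #>\<^bsub>G\<^esub> y"
    using difference_set_fixed_translate[OF assms(10) _ _ _ g img] by blast
  have ds: "difference_set G v k l (D #>\<^bsub>G\<^esub> y)"
    using difference_set_translate[OF assms(10) y] .
  interpret stable_difference_set G v k l p "D #>\<^bsub>G\<^esub> y" fst z
  proof
    show "difference_set G v k l (D #>\<^bsub>G\<^esub> y)" "prime p" "z \<in> carrier G" "z \<noteq> \<one>\<^bsub>G\<^esub>"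
      "z [^]\<^bsub>G\<^esub> p = \<one>\<^bsub>G\<^esub>" "2 * k < v"
      by fact+
    show "l + 1 < k"
      using assms(12) by simp
    show "int p dvd fst z"
      using f by (simp add: z_def dvd_power)
    show "[fst (x \<otimes>\<^bsub>G\<^esub> x') = fst x + fst x'] (mod int p)" for x x'
      using p_dvd_q by (cases x; cases x') (simp add: mult cong_def mod_mod_cancel)
    \<comment> \<open>The first coordinates divisible by \<open>p\<close> are \<open>p * i\<close>
      with \<open>i < p ^ f\<close>, which gives the subgroup index \<open>p\<close>.\<close>
    have "{x \<in> carrier G. int p dvd fst x} = (\<lambda>(i, h). (int p * i, h)) ` ({0..<int p ^ f} \<times> carrier H)"
    proof -
      have "int p * i < int p * int p ^ f \<longleftrightarrow> i < int p ^ f" "0 \<le> int p * i \<longleftrightarrow> 0 \<le> i" for i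
        using p by (simp_all add: zero_le_mult_iff)
      then show ?thesis
        by (force simp: carrier qf image_iff elim!: dvdE)
    qed
    moreover have "inj_on (\<lambda>(i, h). (int p * i, h)) ({0..<int p ^ f} \<times> carrier H)"
      using p by (auto simp: inj_on_def)
    ultimately have "card {x \<in> carrier G. int p dvd fst x} = p ^ f * card (carrier H)"
      by (simp add: card_image card_cartesian_product nat_power_eq)
    moreover have "v = q * card (carrier H)"
      using ds by (simp add: difference_set_def order_def carrier card_cartesian_product)
    ultimately show "p * card {x \<in> carrier G. int p dvd fst x} = v"
      by (simp add: q_def f)
    show "d \<otimes>\<^bsub>G\<^esub> z [^]\<^bsub>G\<^esub> fst d \<in> D #>\<^bsub>G\<^esub> y" if "d \<in> D #>\<^bsub>G\<^esub> y" for d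
    proof -
      have "d \<in> carrier G"
        using ds that by (auto simp: difference_set_def)
      then show ?thesis
        using fixed that twist by (metis imageI)
    qed
  qed
  show False
    using assms(13) p_eq_two hadamard not_cyclic by blast
qed

end
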